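(* Let $G$ be a group and $A \subseteq G$. Then $A$ is strongly generic if and only if the characteristic function $\chi_A$ is an almost periodic point of the $G$-flow $2^G$.
   Context: A subset $B\subseteq G$ is generic if $G = g_1B\cup\dots\cup g_nB$ for some $g_1,\dots,g_n\in G$. A subset $A\subseteq G$ is strongly generic if every non-empty set in the smallest family of subsets of $G$ containing $A$ and closed under finite unions, complements and left translations $X\mapsto gX$ is generic. The space $2^G$ (product topology) is a $G$-flow under the action $(g\odot f)(x)=f(xg)$ for $g,x\in G$, $f\in 2^G$ (equivalently $g\odot\chi_A=\chi_{Ag^{-1}}$). A point $f\in 2^G$ is almost periodic if the closure of its orbit $\mathrm{cl}(G\odot f)$ is a minimal subflow, i.e. a non-empty closed $G$-invariant set with no non-empty proper closed $G$-invariant subset. *)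

theory Defs
  imports "HOL-Analysis.Analysis" "HOL-Algebra.Group_Action"
begin

section \<open>Generic and strongly generic sets\<close>

definition generic :: "('a, 'm) monoid_scheme \<Rightarrow> 'a set \<Rightarrow> bool" where
  "generic G B \<longleftrightarrow> B \<subseteq> carrier G \<and>
     (\<exists>S. finite S \<and> S \<subseteq> carrier G \<and> carrier G = (\<Union>g\<in>S. g <#\<^bsub>G\<^esub> B))"

text \<open>The empty union is covered, as the complement of \<open>A \<union> (carrier G - A)\<close>.\<close>

inductive_set translation_algebra :: "('a, 'm) monoid_scheme \<Rightarrow> 'a set \<Rightarrow> 'a set set"
  for G :: "('a, 'm) monoid_scheme" and A :: "'a set"
  where
    base: "A \<in> translation_algebra G A"
  | union: "X \<in> translation_algebra G A \<Longrightarrow> Y \<in> translation_algebra G A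
      \<Longrightarrow> X \<union> Y \<in> translation_algebra G A"
  | complement: "X \<in> translation_algebra G A \<Longrightarrow> carrier G - X \<in> translation_algebra G A"
  | translate: "X \<in> translation_algebra G A \<Longrightarrow> g \<in> carrier G
      \<Longrightarrow> g <#\<^bsub>G\<^esub> X \<in> translation_algebra G A"

definition strongly_generic :: "('a, 'm) monoid_scheme \<Rightarrow> 'a set \<Rightarrow> bool" where
  "strongly_generic G A \<longleftrightarrow> A \<subseteq> carrier G \<and>
     (\<forall>B \<in> translation_algebra G A. B \<noteq> {} \<longrightarrow> generic G B)"


section \<open>Flows and almost periodic points\<close>

locale G_flow = group_action G "topspace X" \<phi>
  for G (structure) and X :: "'b topology" and \<phi> +
  assumes compact: "compact_space X"
    and Hausdorff: "Hausdorff_space X"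
    and continuous: "g \<in> carrier G \<Longrightarrow> continuous_map X X (\<phi> g)"

definition subflow ::
    "('a, 'm) monoid_scheme \<Rightarrow> 'b topology \<Rightarrow> ('a \<Rightarrow> 'b \<Rightarrow> 'b) \<Rightarrow> 'b set \<Rightarrow> bool" where
  "subflow G X \<phi> Y \<longleftrightarrow> Y \<noteq> {} \<and> closedin X Y \<and> (\<forall>g\<in>carrier G. \<forall>y\<in>Y. \<phi> g y \<in> Y)"

definition minimal_subflow ::
    "('a, 'm) monoid_scheme \<Rightarrow> 'b topology \<Rightarrow> ('a \<Rightarrow> 'b \<Rightarrow> 'b) \<Rightarrow> 'b set \<Rightarrow> bool" where
  "minimal_subflow G X \<phi> Y \<longleftrightarrow> subflow G X \<phi> Y \<and> \<not> (\<exists>Z. Z \<subset> Y \<and> subflow G X \<phi> Z)"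

definition almost_periodic ::
    "('a, 'm) monoid_scheme \<Rightarrow> 'b topology \<Rightarrow> ('a \<Rightarrow> 'b \<Rightarrow> 'b) \<Rightarrow> 'b \<Rightarrow> bool" where
  "almost_periodic G X \<phi> x \<longleftrightarrow>
     x \<in> topspace X \<and> minimal_subflow G X \<phi> (X closure_of (orbit G \<phi> x))"


section \<open>The flow of subsets of a group\<close>

text \<open>
  The two-element space is the discrete space of truth values, and a function on \<open>G\<close> is an
  extensional function on \<open>carrier G\<close>.
\<close>

definition two_power :: "('a, 'm) monoid_scheme \<Rightarrow> ('a \<Rightarrow> bool) topology" where
  "two_power G = product_topology (\<lambda>_. discrete_topology (UNIV :: bool set)) (carrier G)"

definition shift :: "('a, 'm) monoid_scheme \<Rightarrow> 'a \<Rightarrow> ('a \<Rightarrow> bool) \<Rightarrow> ('a \<Rightarrow> bool)" where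
  "shift G g = (\<lambda>f\<in>topspace (two_power G). \<lambda>x\<in>carrier G. f (x \<otimes>\<^bsub>G\<^esub> g))"

definition char_fun :: "('a, 'm) monoid_scheme \<Rightarrow> 'a set \<Rightarrow> ('a \<Rightarrow> bool)" where
  "char_fun G A = (\<lambda>x\<in>carrier G. x \<in> A)"

lemma topspace_two_power: "topspace (two_power G) = (carrier G \<rightarrow>\<^sub>E UNIV)"
  by (simp add: two_power_def)

lemma char_fun_in_two_power: "char_fun G A \<in> topspace (two_power G)"
  by (simp add: topspace_two_power char_fun_def)

lemma shift_closed: "shift G g \<in> topspace (two_power G) \<rightarrow> topspace (two_power G)"
  by (simp add: shift_def topspace_two_power)

context group
begin

lemma shift_char_fun:
  assumes "A \<subseteq> carrier G" "g \<in> carrier G"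
  shows "shift G g (char_fun G A) = char_fun G (A #> inv g)"
proof -
  have "x \<otimes> g \<in> A \<longleftrightarrow> x \<in> A #> inv g" if "x \<in> carrier G" for x
  proof
    assume "x \<otimes> g \<in> A"
    moreover have "x = (x \<otimes> g) \<otimes> inv g"
      using that assms by (simp add: m_assoc)
    ultimately show "x \<in> A #> inv g"
      unfolding r_coset_def by blast
  next
    assume "x \<in> A #> inv g"
    then obtain a where "a \<in> A" "x = a \<otimes> inv g"
      unfolding r_coset_def by blast
    then show "x \<otimes> g \<in> A"
      using assms by (auto simp: m_assoc subset_iff)
  qed
  then show ?thesis
    using assms by (auto simp: shift_def char_fun_def topspace_two_power fun_eq_iff)
qed

lemma shift_one: "f \<in> topspace (two_power G) \<Longrightarrow> shift G \<one> f = f"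
  by (auto simp: shift_def topspace_two_power PiE_def extensional_def fun_eq_iff)

lemma shift_mult:
  assumes "g \<in> carrier G" "h \<in> carrier G" "f \<in> topspace (two_power G)"
  shows "shift G (g \<otimes> h) f = shift G g (shift G h f)"
  using assms by (auto simp: shift_def topspace_two_power m_assoc fun_eq_iff)

lemma shift_in_Bij:
  assumes g: "g \<in> carrier G"
  shows "shift G g \<in> Bij (topspace (two_power G))"
proof -
  have "bij_betw (shift G g) (topspace (two_power G)) (topspace (two_power G))"
  proof (rule bij_betwI[where g = "shift G (inv g)"])
    show "shift G (inv g) (shift G g f) = f" if "f \<in> topspace (two_power G)" for f
      using shift_mult[of "inv g" g f] shift_one that g by simp
    show "shift G g (shift G (inv g) f) = f" if "f \<in> topspace (two_power G)" for f
      using shift_mult[of g "inv g" f] shift_one that g by simp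
  qed (rule shift_closed)+
  moreover have "shift G g \<in> extensional (topspace (two_power G))"
    by (simp add: shift_def)
  ultimately show ?thesis
    by (simp add: Bij_def)
qed

lemma continuous_shift:
  assumes g: "g \<in> carrier G"
  shows "continuous_map (two_power G) (two_power G) (shift G g)"
proof -
  have "continuous_map (two_power G) (discrete_topology (UNIV :: bool set))
          (\<lambda>f. shift G g f x)" if "x \<in> carrier G" for x
  proof (rule continuous_map_eq)
    show "continuous_map (two_power G) (discrete_topology (UNIV :: bool set))
            (\<lambda>f. f (x \<otimes> g))"
      unfolding two_power_def using that g by (intro continuous_map_product_projection) simp
  qed (simp add: shift_def that)
  moreover have "shift G g ` topspace (two_power G) \<subseteq> extensional (carrier G)"
    by (auto simp: shift_def)
  ultimately show ?thesis
    by (subst (2) two_power_def) (auto simp: continuous_map_componentwise)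
qed

theorem G_flow_two_power: "G_flow G (two_power G) (shift G)"
proof -
  have "shift G \<in> hom G (BijGroup (topspace (two_power G)))"
  proof (rule homI)
    fix g h assume gh: "g \<in> carrier G" "h \<in> carrier G"
    have "shift G (g \<otimes> h) = compose (topspace (two_power G)) (shift G g) (shift G h)"
      using gh by (auto simp: fun_eq_iff compose_def shift_mult)
                  (auto simp: shift_def)
    then show "shift G (g \<otimes> h)
        = shift G g \<otimes>\<^bsub>BijGroup (topspace (two_power G))\<^esub> shift G h"
      using gh by (simp add: BijGroup_def shift_in_Bij)
  qed (simp add: BijGroup_def shift_in_Bij)
  then have "group_action G (topspace (two_power G)) (shift G)"
    by (simp add: group_action_def group_hom_def group_hom_axioms_def group_BijGroup)
  moreover have "compact_space (two_power G)"
    by (simp add: two_power_def compact_space_product_topology compact_space_discrete_topology)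
  moreover have "Hausdorff_space (two_power G)"
    by (simp add: two_power_def Hausdorff_space_product_topology)
  ultimately show ?thesis
    using continuous_shift by (simp add: G_flow_def G_flow_axioms_def)
qed

end

end

(* A subset of 2^G meets every neighbourhood of f iff it contains, for each finite F, a function
   agreeing with f on F.  The set of g for which the g-translate of chi_A agrees with chi_A on F
   is a finite Boolean combination of left translates of A, and conversely every non-empty set in
   the algebra generated by A contains a left translate of such a set of return times.  So A is
   strongly generic iff all these sets of return times are generic, and, by compactness of orbit
   closures, this is equivalent to minimality of the orbit closure of chi_A. *)

theory Submission
  imports Defs
begin

section \<open>Minimality, recurrence and return to neighbourhoods in an arbitrary flow\<close>

context G_flow
begin

lemma orbit_subset_topspace:
  assumes "x \<in> topspace X"
  shows "orbit G \<phi> x \<subseteq> topspace X"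
  using assms element_image by (auto simp: orbit_def)

lemma self_in_orbit_closure:
  assumes "x \<in> topspace X"
  shows "x \<in> X closure_of orbit G \<phi> x"
proof -
  have "x \<in> orbit G \<phi> x"
    using orbit_refl assms by blast
  with closure_of_subset[OF orbit_subset_topspace[OF assms]] show ?thesis
    by blast
qed

text \<open>Each \<open>\<phi> g\<close> maps the orbit into itself because
  \<open>\<phi> g (\<phi> h x)\<close> is \<open>\<phi> (g \<otimes> h) x\<close>. Continuity
  carries this invariance over to the closure.\<close>

lemma subflow_orbit_closure:
  assumes x: "x \<in> topspace X"
  shows "subflow G X \<phi> (X closure_of orbit G \<phi> x)"
  unfolding subflow_def
proof (intro conjI ballI)
  show "X closure_of orbit G \<phi> x \<noteq> {}"
    using self_in_orbit_closure[OF x] by blast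
  show "closedin X (X closure_of orbit G \<phi> x)"
    by simp
  fix g y assume g: "g \<in> carrier G" and y: "y \<in> X closure_of orbit G \<phi> x"
  have "\<phi> g ` orbit G \<phi> x \<subseteq> orbit G \<phi> x"
  proof clarify
    fix z assume "z \<in> orbit G \<phi> x"
    then obtain h where h: "h \<in> carrier G" "z = \<phi> h x"
      by (auto simp: orbit_def)
    then have "\<phi> g z = \<phi> (g \<otimes> h) x"
      using composition_rule x g by simp
    moreover have "g \<otimes> h \<in> carrier G"
      using g h group_hom by (simp add: group_hom_def group.is_monoid monoid.m_closed)
    ultimately show "\<phi> g z \<in> orbit G \<phi> x"
      by (auto simp: orbit_def)
  qed
  then have "X closure_of (\<phi> g ` orbit G \<phi> x) \<subseteq> X closure_of orbit G \<phi> x"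
    by (rule closure_of_mono)
  moreover have "\<phi> g y \<in> X closure_of (\<phi> g ` orbit G \<phi> x)"
    using continuous_map_image_closure_subset[OF continuous[OF g]] y by blast
  ultimately show "\<phi> g y \<in> X closure_of orbit G \<phi> x"
    by blast
qed

lemma orbit_closure_subset_subflow:
  assumes "subflow G X \<phi> Z" "z \<in> Z"
  shows "X closure_of orbit G \<phi> z \<subseteq> Z"
  using assms by (intro closure_of_minimal) (auto simp: subflow_def orbit_def)

text \<open>A subflow contains the orbit closure of each of its points, so minimality need only be
  tested on the orbit closures of points \<open>y\<close> of the orbit closure of \<open>x\<close>.
  Such a closure is always contained in that of \<open>x\<close>, and it is all of it as soon as it
  contains \<open>x\<close>.\<close>

lemma almost_periodic_iff_recurrent:
  assumes x: "x \<in> topspace X"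
  shows "almost_periodic G X \<phi> x \<longleftrightarrow>
    (\<forall>y \<in> X closure_of orbit G \<phi> x. x \<in> X closure_of orbit G \<phi> y)"
proof
  assume ap: "almost_periodic G X \<phi> x"
  show "\<forall>y \<in> X closure_of orbit G \<phi> x. x \<in> X closure_of orbit G \<phi> y"
  proof
    fix y assume y: "y \<in> X closure_of orbit G \<phi> x"
    then have "y \<in> topspace X"
      using closure_of_subset_topspace by fast
    then have "subflow G X \<phi> (X closure_of orbit G \<phi> y)"
      by (rule subflow_orbit_closure)
    moreover have "X closure_of orbit G \<phi> y \<subseteq> X closure_of orbit G \<phi> x"
      using orbit_closure_subset_subflow[OF subflow_orbit_closure[OF x] y] .
    ultimately have "X closure_of orbit G \<phi> y = X closure_of orbit G \<phi> x"
      using ap unfolding almost_periodic_def minimal_subflow_def by blast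
    then show "x \<in> X closure_of orbit G \<phi> y"
      using self_in_orbit_closure[OF x] by simp
  qed
next
  assume rec: "\<forall>y \<in> X closure_of orbit G \<phi> x. x \<in> X closure_of orbit G \<phi> y"
  have "\<not> Z \<subset> X closure_of orbit G \<phi> x" if Z: "subflow G X \<phi> Z" for Z
  proof
    assume sub: "Z \<subset> X closure_of orbit G \<phi> x"
    obtain z where z: "z \<in> Z"
      using Z by (auto simp: subflow_def)
    then have "x \<in> Z"
      using rec sub orbit_closure_subset_subflow[OF Z z] by blast
    then show False
      using orbit_closure_subset_subflow[OF Z] sub by blast
  qed
  then show "almost_periodic G X \<phi> x"
    unfolding almost_periodic_def minimal_subflow_def
    using x subflow_orbit_closure[OF x] by blast
qed

text \<open>By recurrence, every \<open>y\<close> in the orbit closure is moved into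
  \<open>U\<close> by some group element. The preimages of \<open>U\<close> under the maps
  \<open>\<phi> g\<close> thus form an open cover of a compact set, and a finite subcover gives one
  \<open>S\<close> that serves all \<open>y\<close> at once.\<close>

lemma almost_periodic_syndetic_return:
  assumes ap: "almost_periodic G X \<phi> x" and U: "openin X U" "x \<in> U"
  obtains S where "finite S" "S \<subseteq> carrier G"
    "\<forall>y \<in> X closure_of orbit G \<phi> x. \<exists>s\<in>S. \<phi> s y \<in> U"
proof -
  let ?O = "X closure_of orbit G \<phi> x"
  let ?V = "\<lambda>g. {y \<in> topspace X. \<phi> g y \<in> U}"
  have x: "x \<in> topspace X"
    using ap by (simp add: almost_periodic_def)
  have "compactin X ?O"
    using compact by (simp add: closedin_compact_space)
  moreover have "openin X W" if "W \<in> ?V ` carrier G" for W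
    using that openin_continuous_map_preimage[OF continuous U(1)] by blast
  moreover have "?O \<subseteq> \<Union> (?V ` carrier G)"
  proof
    fix y assume y: "y \<in> ?O"
    then have "x \<in> X closure_of orbit G \<phi> y"
      using ap almost_periodic_iff_recurrent[OF x] by blast
    then obtain t where "t \<in> orbit G \<phi> y" "t \<in> U"
      using U by (auto simp: in_closure_of)
    then obtain g where "g \<in> carrier G" "\<phi> g y \<in> U"
      by (auto simp: orbit_def)
    moreover have "y \<in> topspace X"
      using y closure_of_subset_topspace by fast
    ultimately show "y \<in> \<Union> (?V ` carrier G)"
      by blast
  qed
  ultimately obtain \<F> where \<F>: "finite \<F>" "\<F> \<subseteq> ?V ` carrier G" "?O \<subseteq> \<Union> \<F>"
    by (metis (no_types, lifting) compactinD)
  obtain S where S: "S \<subseteq> carrier G" "finite S" "\<F> = ?V ` S"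
    using finite_subset_image[OF \<F>(1,2)] by blast
  show thesis
  proof (rule that[OF S(2,1)], rule ballI)
    fix y assume "y \<in> ?O"
    then show "\<exists>s\<in>S. \<phi> s y \<in> U"
      using \<F>(3) S(3) by blast
  qed
qed

end

section \<open>Return times, and sets determined by a finite window\<close>

definition return_times :: "('a, 'm) monoid_scheme \<Rightarrow> 'a set \<Rightarrow> 'a set \<Rightarrow> 'a set" where
  "return_times G A F = {g \<in> carrier G. \<forall>x\<in>F. x \<otimes>\<^bsub>G\<^esub> g \<in> A \<longleftrightarrow> x \<in> A}"

text \<open>For \<open>B\<close> inside the group and finite \<open>F\<close>, this says that
  \<open>B\<close> is a union of atoms of the Boolean algebra generated by the left translates of
  \<open>A\<close> by inverses of elements of \<open>F\<close>. Phrasing it through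
  indistinguishable points \<open>g\<close> and \<open>h\<close> avoids Boolean normal
  forms.\<close>

definition determined_by ::
    "('a, 'm) monoid_scheme \<Rightarrow> 'a set \<Rightarrow> 'a set \<Rightarrow> 'a set \<Rightarrow> bool" where
  "determined_by G A F B \<longleftrightarrow> (\<forall>g\<in>carrier G. \<forall>h\<in>carrier G.
     (\<forall>x\<in>F. x \<otimes>\<^bsub>G\<^esub> g \<in> A \<longleftrightarrow> x \<otimes>\<^bsub>G\<^esub> h \<in> A) \<longrightarrow> (g \<in> B \<longleftrightarrow> h \<in> B))"

lemma determined_byD:
  assumes "determined_by G A F B" "g \<in> carrier G" "h \<in> carrier G"
    "\<And>x. x \<in> F \<Longrightarrow> x \<otimes>\<^bsub>G\<^esub> g \<in> A \<longleftrightarrow> x \<otimes>\<^bsub>G\<^esub> h \<in> A"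
  shows "g \<in> B \<longleftrightarrow> h \<in> B"
  using assms(1)[unfolded determined_by_def, rule_format, OF assms(2-4)] .

section \<open>The topology of \<open>two_power G\<close> in terms of agreement on finite
  sets\<close>

lemma openin_two_power_cylinder:
  assumes "finite F"
  shows "openin (two_power G) {h \<in> topspace (two_power G). \<forall>x\<in>F. h x = f x}"
proof -
  have "openin (two_power G) {h \<in> topspace (two_power G). h x = f x}" for x
  proof (cases "x \<in> carrier G")
    case True
    then have "continuous_map (two_power G) (discrete_topology UNIV) (\<lambda>h. h x)"
      unfolding two_power_def by (rule continuous_map_product_projection)
    from openin_continuous_map_preimage[OF this, of "{f x}"] show ?thesis
      by simp
  next
    \<comment> \<open>All points of the space take the value \<open>undefined\<close> outside the
      group, so the condition at such an \<open>x\<close> is met by every point or by none.\<close>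
    case False
    then have "h x = undefined" if "h \<in> topspace (two_power G)" for h
      using that by (auto simp: topspace_two_power PiE_def extensional_def)
    then have "{h \<in> topspace (two_power G). h x = f x}
        = (if f x = undefined then topspace (two_power G) else {})"
      by auto
    then show ?thesis
      by simp
  qed
  with assms show ?thesis
  proof (induction F)
    case (insert a F)
    have "{h \<in> topspace (two_power G). \<forall>x\<in>insert a F. h x = f x} =
        {h \<in> topspace (two_power G). h a = f a} \<inter>
        {h \<in> topspace (two_power G). \<forall>x\<in>F. h x = f x}"
      by auto
    with insert show ?case
      by (metis (no_types, lifting) openin_Int)
  qed simp
qed

text \<open>In one direction, the cylinder around \<open>f\<close> over \<open>F\<close> is an open
  neighbourhood. In the other, a basic open box around \<open>f\<close> restricts only finitely many
  coordinates, so any point that agrees with \<open>f\<close> on these lies in the box.\<close>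

lemma in_closure_of_two_power_iff:
  assumes f: "f \<in> topspace (two_power G)" and T: "T \<subseteq> topspace (two_power G)"
  shows "f \<in> two_power G closure_of T \<longleftrightarrow>
    (\<forall>F. finite F \<and> F \<subseteq> carrier G \<longrightarrow> (\<exists>t\<in>T. \<forall>x\<in>F. t x = f x))"
proof (intro iffI allI impI)
  fix F assume cl: "f \<in> two_power G closure_of T" and F: "finite F \<and> F \<subseteq> carrier G"
  have "openin (two_power G) {h \<in> topspace (two_power G). \<forall>x\<in>F. h x = f x}"
    using F by (intro openin_two_power_cylinder) simp
  moreover have "f \<in> {h \<in> topspace (two_power G). \<forall>x\<in>F. h x = f x}"
    using f by simp
  ultimately obtain t where "t \<in> T" "t \<in> {h \<in> topspace (two_power G). \<forall>x\<in>F. h x = f x}"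
    using cl unfolding in_closure_of by meson
  then show "\<exists>t\<in>T. \<forall>x\<in>F. t x = f x"
    by blast
next
  assume *: "\<forall>F. finite F \<and> F \<subseteq> carrier G \<longrightarrow> (\<exists>t\<in>T. \<forall>x\<in>F. t x = f x)"
  have "\<exists>t. t \<in> T \<and> t \<in> U" if U: "f \<in> U" "openin (two_power G) U" for U
  proof -
    obtain V where V: "finite {i \<in> carrier G. V i \<noteq> UNIV}" "f \<in> Pi\<^sub>E (carrier G) V"
        "Pi\<^sub>E (carrier G) V \<subseteq> U"
      using U unfolding two_power_def openin_product_topology_alt by fastforce
    obtain t where t: "t \<in> T" "\<forall>x\<in>{i \<in> carrier G. V i \<noteq> UNIV}. t x = f x"
      using * V(1) by (metis (no_types, lifting) mem_Collect_eq subsetI)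
    have "t \<in> Pi\<^sub>E (carrier G) V"
    proof (rule PiE_I)
      fix x assume "x \<in> carrier G"
      then show "t x \<in> V x"
        using t(2) V(2) by (cases "V x = UNIV") (auto simp: PiE_iff)
    next
      fix x assume "x \<notin> carrier G"
      then show "t x = undefined"
        using t(1) T by (auto simp: topspace_two_power PiE_def extensional_def)
    qed
    then show ?thesis
      using t(1) V(3) by blast
  qed
  then show "f \<in> two_power G closure_of T"
    using f by (auto simp: in_closure_of)
qed

section \<open>Generic sets and left translation\<close>

context group
begin

lemma in_l_coset_iff:
  assumes "X \<subseteq> carrier G" "g \<in> carrier G" "h \<in> carrier G"
  shows "h \<in> g <# X \<longleftrightarrow> inv g \<otimes> h \<in> X"
proof
  assume "h \<in> g <# X"
  then show "inv g \<otimes> h \<in> X"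
    using assms by (auto simp: l_coset_def m_assoc[symmetric] subset_iff)
next
  assume "inv g \<otimes> h \<in> X"
  moreover have "h = g \<otimes> (inv g \<otimes> h)"
    using assms by (simp add: m_assoc[symmetric])
  ultimately show "h \<in> g <# X"
    unfolding l_coset_def by blast
qed

text \<open>Since \<open>g\<close> lies in \<open>s <# B\<close> exactly when
  \<open>inv s \<otimes> g\<close> lies in \<open>B\<close>, replacing \<open>S\<close> by the set
  of its inverses turns one form into the other. The products \<open>s \<otimes> g\<close> are the
  ones that arise when shifts by \<open>g\<close> and then by \<open>s\<close> are composed.\<close>

lemma generic_iff:
  assumes B: "B \<subseteq> carrier G"
  shows "generic G B \<longleftrightarrow>
    (\<exists>S. finite S \<and> S \<subseteq> carrier G \<and> (\<forall>g\<in>carrier G. \<exists>s\<in>S. s \<otimes> g \<in> B))"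
proof
  assume "generic G B"
  then obtain S where S: "finite S" "S \<subseteq> carrier G" "carrier G = (\<Union>g\<in>S. g <# B)"
    unfolding generic_def by (elim conjE exE)
  have "\<exists>s\<in>m_inv G ` S. s \<otimes> g \<in> B" if "g \<in> carrier G" for g
  proof -
    have "g \<in> (\<Union>s\<in>S. s <# B)"
      using equalityD1[OF S(3)] that by (rule subsetD)
    then obtain s where s: "s \<in> S" "g \<in> s <# B"
      by (rule UN_E)
    then have "inv s \<otimes> g \<in> B"
      using in_l_coset_iff[OF B, of s g] S(2) that by blast
    with s(1) show ?thesis
      by blast
  qed
  moreover have "finite (m_inv G ` S)" "m_inv G ` S \<subseteq> carrier G"
    using S(1,2) by auto
  ultimately show "\<exists>S. finite S \<and> S \<subseteq> carrier G \<and> (\<forall>g\<in>carrier G. \<exists>s\<in>S. s \<otimes> g \<in> B)"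
    by blast
next
  assume "\<exists>S. finite S \<and> S \<subseteq> carrier G \<and> (\<forall>g\<in>carrier G. \<exists>s\<in>S. s \<otimes> g \<in> B)"
  then obtain S where S: "finite S" "S \<subseteq> carrier G"
      "\<And>g. g \<in> carrier G \<Longrightarrow> \<exists>s\<in>S. s \<otimes> g \<in> B"
    by blast
  have "g \<in> (\<Union>s\<in>m_inv G ` S. s <# B)" if g: "g \<in> carrier G" for g
  proof -
    obtain s where "s \<in> S" "s \<otimes> g \<in> B"
      using S(3) g by blast
    moreover from this have "g \<in> inv s <# B"
      using in_l_coset_iff[OF B, of "inv s" g] S(2) g by (simp add: subset_iff)
    ultimately show ?thesis
      by blast
  qed
  moreover have "(\<Union>s\<in>m_inv G ` S. s <# B) \<subseteq> carrier G"
    using S(2) l_coset_subset_G[OF B] by blast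
  ultimately have "carrier G = (\<Union>s\<in>m_inv G ` S. s <# B)"
    by (intro equalityI subsetI) (assumption | erule subsetD)+
  moreover have "finite (m_inv G ` S)" "m_inv G ` S \<subseteq> carrier G"
    using S(1,2) by auto
  ultimately show "generic G B"
    using B unfolding generic_def by (intro conjI exI[of _ "m_inv G ` S"])
qed

lemma genericE:
  assumes "generic G B"
  obtains S where "finite S" "S \<subseteq> carrier G" "\<forall>g\<in>carrier G. \<exists>s\<in>S. s \<otimes> g \<in> B"
proof -
  have "B \<subseteq> carrier G"
    using assms unfolding generic_def by (rule conjunct1)
  from assms[unfolded generic_iff[OF this]] show thesis
    using that by meson
qed

lemma generic_mono:
  assumes "generic G B" "B \<subseteq> C" "C \<subseteq> carrier G"
  shows "generic G C"
  using assms generic_iff[of B] generic_iff[of C] by (meson order_trans subsetD)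

text \<open>If \<open>S\<close> works for \<open>B\<close>, then the products
  \<open>b \<otimes> s\<close> work for the translate.\<close>

lemma generic_l_coset:
  assumes "generic G B" "b \<in> carrier G"
  shows "generic G (b <# B)"
proof -
  have B: "B \<subseteq> carrier G"
    using assms(1) unfolding generic_def by (rule conjunct1)
  obtain S where S: "finite S" "S \<subseteq> carrier G"
      "\<forall>g\<in>carrier G. \<exists>s\<in>S. s \<otimes> g \<in> B"
    using genericE[OF assms(1)] by metis
  have "\<exists>s\<in>(\<otimes>) b ` S. s \<otimes> g \<in> b <# B" if g: "g \<in> carrier G" for g
  proof -
    obtain s where "s \<in> S" "s \<otimes> g \<in> B"
      using S(3) g by blast
    moreover from this have "(b \<otimes> s) \<otimes> g = b \<otimes> (s \<otimes> g)"
      using m_assoc[OF assms(2) subsetD[OF S(2)] g] by simp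
    ultimately show ?thesis
      by (auto simp: l_coset_def)
  qed
  moreover have "finite ((\<otimes>) b ` S)" "(\<otimes>) b ` S \<subseteq> carrier G"
    using S(1,2) assms(2) by auto
  ultimately show ?thesis
    unfolding generic_iff[OF l_coset_subset_G[OF B assms(2)]] by blast
qed

section \<open>The algebra generated by the left translates of \<open>A\<close>\<close>

lemma translation_algebra_subset:
  assumes "A \<subseteq> carrier G" "B \<in> translation_algebra G A"
  shows "B \<subseteq> carrier G"
  using assms(2) by induction (use assms(1) l_coset_subset_G in auto)

lemma translation_algebra_Int:
  assumes A: "A \<subseteq> carrier G"
    and X: "X \<in> translation_algebra G A" and Y: "Y \<in> translation_algebra G A"
  shows "X \<inter> Y \<in> translation_algebra G A"
proof -
  have "X \<inter> Y = carrier G - ((carrier G - X) \<union> (carrier G - Y))"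
    using translation_algebra_subset[OF A] X Y by blast
  with X Y show ?thesis
    by (metis translation_algebra.complement translation_algebra.union)
qed

lemma carrier_in_translation_algebra:
  assumes "A \<subseteq> carrier G"
  shows "carrier G \<in> translation_algebra G A"
proof -
  have "A \<union> (carrier G - A) = carrier G"
    using assms by blast
  then show ?thesis
    by (metis translation_algebra.base translation_algebra.complement translation_algebra.union)
qed

text \<open>Each \<open>a\<close> in \<open>F\<close> imposes one condition on \<open>g\<close>,
  which cuts out \<open>inv a <# A\<close> if \<open>a\<close> is in \<open>A\<close> and the
  complement of that translate otherwise. The set of return times is the finite intersection of
  these.\<close>

lemma return_times_in_translation_algebra:
  assumes A: "A \<subseteq> carrier G" and F: "finite F" "F \<subseteq> carrier G"
  shows "return_times G A F \<in> translation_algebra G A"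
  using F
proof (induction F)
  case empty
  then show ?case
    using carrier_in_translation_algebra[OF A] by (simp add: return_times_def)
next
  case (insert a F)
  have L: "inv a <# A \<in> translation_algebra G A"
    using insert.prems by (intro translation_algebra.translate translation_algebra.base) simp
  have "g \<in> inv a <# A \<longleftrightarrow> a \<otimes> g \<in> A" if "g \<in> carrier G" for g
    using in_l_coset_iff[OF A, of "inv a" g] insert.prems that by simp
  then have "return_times G A (insert a F) =
      (if a \<in> A then inv a <# A else carrier G - (inv a <# A)) \<inter> return_times G A F"
    by (auto simp: return_times_def)
  moreover have "(if a \<in> A then inv a <# A else carrier G - (inv a <# A)) \<in> translation_algebra G A"
    using L translation_algebra.complement[OF L] by simp
  ultimately show ?case
    using insert translation_algebra_Int[OF A] by simp
qed

text \<open>The window is built along the generation of \<open>B\<close>: it is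
  \<open>{\<one>}\<close> for \<open>A\<close> itself, the union of two windows for a union,
  unchanged for a complement, and multiplied on the right by \<open>inv k\<close> for a translate by
  \<open>k\<close>.\<close>

lemma translation_algebra_finitely_determined:
  assumes A: "A \<subseteq> carrier G" and B: "B \<in> translation_algebra G A"
  shows "\<exists>F. finite F \<and> F \<subseteq> carrier G \<and> determined_by G A F B"
  using B
proof induction
  case base
  have "determined_by G A {\<one>} A"
    by (simp add: determined_by_def)
  then show ?case
    by (intro exI[of _ "{\<one>}"]) simp
next
  case (union X Y)
  obtain F where F: "finite F" "F \<subseteq> carrier G" "determined_by G A F X"
    using union.IH(1) by (elim exE conjE)
  obtain F' where F': "finite F'" "F' \<subseteq> carrier G" "determined_by G A F' Y"
    using union.IH(2) by (elim exE conjE)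
  have "determined_by G A (F \<union> F') (X \<union> Y)"
    unfolding determined_by_def
  proof (intro ballI impI)
    fix g h
    assume gh: "g \<in> carrier G" "h \<in> carrier G"
      and eq: "\<forall>x\<in>F \<union> F'. x \<otimes> g \<in> A \<longleftrightarrow> x \<otimes> h \<in> A"
    have "g \<in> X \<longleftrightarrow> h \<in> X"
      using eq by (intro determined_byD[OF F(3) gh]) simp
    moreover have "g \<in> Y \<longleftrightarrow> h \<in> Y"
      using eq by (intro determined_byD[OF F'(3) gh]) simp
    ultimately show "g \<in> X \<union> Y \<longleftrightarrow> h \<in> X \<union> Y"
      by simp
  qed
  with F F' show ?case
    by (intro exI[of _ "F \<union> F'"]) simp
next
  case (complement X)
  obtain F where F: "finite F" "F \<subseteq> carrier G" "determined_by G A F X"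
    using complement.IH by (elim exE conjE)
  have "determined_by G A F (carrier G - X)"
    unfolding determined_by_def
  proof (intro ballI impI)
    fix g h
    assume gh: "g \<in> carrier G" "h \<in> carrier G"
      and eq: "\<forall>x\<in>F. x \<otimes> g \<in> A \<longleftrightarrow> x \<otimes> h \<in> A"
    have "g \<in> X \<longleftrightarrow> h \<in> X"
      using eq by (intro determined_byD[OF F(3) gh]) simp
    then show "g \<in> carrier G - X \<longleftrightarrow> h \<in> carrier G - X"
      using gh by simp
  qed
  with F(1,2) show ?case
    by metis
next
  case (translate X k)
  obtain F where F: "finite F" "F \<subseteq> carrier G" "determined_by G A F X"
    using translate.IH by (elim exE conjE)
  \<comment> \<open>Membership of \<open>g\<close> in \<open>k <# X\<close> is membership of
    \<open>inv k \<otimes> g\<close> in \<open>X\<close>, and testing the latter at \<open>x\<close>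
    means testing \<open>g\<close> at \<open>x \<otimes> inv k\<close>.\<close>
  let ?F = "(\<lambda>x. x \<otimes> inv k) ` F"
  have X: "X \<subseteq> carrier G"
    using translation_algebra_subset[OF A translate.hyps(1)] .
  have k: "k \<in> carrier G"
    using translate.hyps by simp
  have "determined_by G A ?F (k <# X)"
    unfolding determined_by_def
  proof (intro ballI impI)
    fix g h
    assume gh: "g \<in> carrier G" "h \<in> carrier G"
      and eq: "\<forall>x\<in>?F. x \<otimes> g \<in> A \<longleftrightarrow> x \<otimes> h \<in> A"
    have "x \<otimes> (inv k \<otimes> g) \<in> A \<longleftrightarrow> x \<otimes> (inv k \<otimes> h) \<in> A" if "x \<in> F" for x
    proof -
      have "x \<in> carrier G"
        using subsetD[OF F(2) that] .
      moreover have "x \<otimes> inv k \<otimes> g \<in> A \<longleftrightarrow> x \<otimes> inv k \<otimes> h \<in> A"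
        using eq that by simp
      ultimately show ?thesis
        using gh k by (simp add: m_assoc)
    qed
    then have "inv k \<otimes> g \<in> X \<longleftrightarrow> inv k \<otimes> h \<in> X"
      using gh k by (intro determined_byD[OF F(3)]) simp_all
    then show "g \<in> k <# X \<longleftrightarrow> h \<in> k <# X"
      using in_l_coset_iff[OF X k] gh by simp
  qed
  moreover have "finite ?F" "?F \<subseteq> carrier G"
    using F(1,2) k by auto
  ultimately show ?case
    by (intro exI[of _ ?F]) simp
qed

lemma strongly_generic_iff_return_times:
  assumes A: "A \<subseteq> carrier G"
  shows "strongly_generic G A \<longleftrightarrow>
    (\<forall>F. finite F \<and> F \<subseteq> carrier G \<longrightarrow> generic G (return_times G A F))"
proof (intro iffI allI impI)
  fix F assume sg: "strongly_generic G A" and F: "finite F \<and> F \<subseteq> carrier G"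
  \<comment> \<open>Strong genericity speaks only of non-empty sets; the identity witnesses that
    this one is non-empty.\<close>
  have "\<one> \<in> return_times G A F"
    using F by (auto simp: return_times_def)
  with sg F show "generic G (return_times G A F)"
    using return_times_in_translation_algebra[OF A] by (auto simp: strongly_generic_def)
next
  assume ret: "\<forall>F. finite F \<and> F \<subseteq> carrier G \<longrightarrow> generic G (return_times G A F)"
  have "generic G B" if B: "B \<in> translation_algebra G A" "B \<noteq> {}" for B
  proof -
    have BG: "B \<subseteq> carrier G"
      using translation_algebra_subset[OF A B(1)] .
    obtain b where b: "b \<in> B"
      using B(2) by blast
    then have bG: "b \<in> carrier G"
      using BG by blast
    obtain F where F: "finite F" "F \<subseteq> carrier G" "determined_by G A F B"
      using translation_algebra_finitely_determined[OF A B(1)] by (elim exE conjE)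
    \<comment> \<open>The window is moved to \<open>b\<close>: for a return time \<open>r\<close>,
      the points \<open>x \<otimes> b \<otimes> r\<close> and \<open>x \<otimes> b\<close> are alike
      with respect to \<open>A\<close> for all \<open>x\<close> in \<open>F\<close>. Hence
      \<open>B\<close> cannot separate \<open>b \<otimes> r\<close> from its element
      \<open>b\<close>.\<close>
    let ?R = "return_times G A ((\<lambda>x. x \<otimes> b) ` F)"
    have "b \<otimes> r \<in> B" if "r \<in> ?R" for r
    proof -
      have r: "r \<in> carrier G" "\<forall>x\<in>F. x \<otimes> b \<otimes> r \<in> A \<longleftrightarrow> x \<otimes> b \<in> A"
        using that by (auto simp: return_times_def)
      have "\<forall>x\<in>F. x \<otimes> (b \<otimes> r) \<in> A \<longleftrightarrow> x \<otimes> b \<in> A"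
        using r bG F(2) by (metis m_assoc subsetD)
      then show ?thesis
        using determined_byD[OF F(3), of "b \<otimes> r" b] r(1) bG b by simp
    qed
    then have "b <# ?R \<subseteq> B"
      by (auto simp: l_coset_def)
    moreover have "(\<lambda>x. x \<otimes> b) ` F \<subseteq> carrier G"
      using F(2) bG by auto
    then have "generic G (b <# ?R)"
      using ret F(1) bG generic_l_coset by blast
    ultimately show ?thesis
      using generic_mono BG by blast
  qed
  then show "strongly_generic G A"
    using A by (simp add: strongly_generic_def)
qed

section \<open>Return times of the characteristic function under the shift\<close>

lemma shift_apply:
  assumes "f \<in> topspace (two_power G)" "x \<in> carrier G"
  shows "shift G g f x = f (x \<otimes> g)"
  using assms by (simp add: shift_def)

lemma shift_char_fun_agrees_iff:
  assumes F: "F \<subseteq> carrier G" and g: "g \<in> carrier G"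
  shows "(\<forall>x\<in>F. shift G g (char_fun G A) x = char_fun G A x) \<longleftrightarrow> g \<in> return_times G A F"
proof -
  have "shift G g (char_fun G A) x = (x \<otimes> g \<in> A)" "char_fun G A x = (x \<in> A)" if "x \<in> F" for x
    using that F g shift_apply[OF char_fun_in_two_power, of x g A] by (auto simp: char_fun_def)
  then show ?thesis
    using g by (auto simp: return_times_def)
qed

lemma return_times_subset: "return_times G A F \<subseteq> carrier G"
  by (auto simp: return_times_def)

text \<open>The cylinder of points that agree with the characteristic function on \<open>F\<close>
  is an open neighbourhood of it, so a finite \<open>S\<close> returns every point of the orbit
  closure to it. Applied to the orbit point \<open>shift G g ?\<chi>\<close>, this makes some
  \<open>s \<otimes> g\<close> a return time, with \<open>S\<close> independent of
  \<open>g\<close>.\<close>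

lemma almost_periodic_imp_generic_return_times:
  assumes ap: "almost_periodic G (two_power G) (shift G) (char_fun G A)"
    and F: "finite F" "F \<subseteq> carrier G"
  shows "generic G (return_times G A F)"
proof -
  interpret flow: G_flow G "two_power G" "shift G"
    by (rule G_flow_two_power)
  let ?\<chi> = "char_fun G A"
  let ?O = "two_power G closure_of orbit G (shift G) ?\<chi>"
  let ?U = "{h \<in> topspace (two_power G). \<forall>x\<in>F. h x = ?\<chi> x}"
  have \<chi>: "?\<chi> \<in> topspace (two_power G)"
    by (rule char_fun_in_two_power)
  have "openin (two_power G) ?U" "?\<chi> \<in> ?U"
    using openin_two_power_cylinder[OF F(1)] \<chi> by simp_all
  with ap obtain S where S: "finite S" "S \<subseteq> carrier G"
      "\<forall>y\<in>?O. \<exists>s\<in>S. shift G s y \<in> ?U"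
    by (rule flow.almost_periodic_syndetic_return)
  have "\<exists>s\<in>S. s \<otimes> g \<in> return_times G A F" if g: "g \<in> carrier G" for g
  proof -
    have "shift G g ?\<chi> \<in> ?O"
      using closure_of_subset[OF flow.orbit_subset_topspace[OF \<chi>]] g
      by (auto simp: orbit_def)
    with S(3) obtain s where s: "s \<in> S" "shift G s (shift G g ?\<chi>) \<in> ?U"
      by (meson bspec bexE)
    have sG: "s \<in> carrier G"
      using S(2) s(1) by (rule subsetD)
    have "\<forall>x\<in>F. shift G (s \<otimes> g) ?\<chi> x = ?\<chi> x"
      using s(2) shift_mult[OF sG g \<chi>] by simp
    then have "s \<otimes> g \<in> return_times G A F"
      using shift_char_fun_agrees_iff[OF F(2), of "s \<otimes> g" A] sG g by simp
    with s(1) show ?thesis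
      by (rule bexI[rotated])
  qed
  with S(1,2) show ?thesis
    unfolding generic_iff[OF return_times_subset] by (intro exI[of _ S]) simp
qed

text \<open>By recurrence it suffices to bring any \<open>y\<close> of the orbit closure back to the
  characteristic function on a given finite \<open>F\<close>. A translate by some \<open>g\<close>
  imitates \<open>y\<close> on a finite set, and genericity corrects \<open>g\<close> to a return
  time \<open>s \<otimes> g\<close>; the shift by \<open>s\<close> then works for \<open>y\<close>
  too.\<close>

lemma generic_return_times_imp_almost_periodic:
  assumes ret: "\<And>F. finite F \<Longrightarrow> F \<subseteq> carrier G \<Longrightarrow> generic G (return_times G A F)"
  shows "almost_periodic G (two_power G) (shift G) (char_fun G A)"
proof -
  interpret flow: G_flow G "two_power G" "shift G"
    by (rule G_flow_two_power)
  let ?\<chi> = "char_fun G A"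
  have \<chi>: "?\<chi> \<in> topspace (two_power G)"
    by (rule char_fun_in_two_power)
  have "?\<chi> \<in> two_power G closure_of orbit G (shift G) y"
    if y: "y \<in> two_power G closure_of orbit G (shift G) ?\<chi>" for y
  proof -
    have yt: "y \<in> topspace (two_power G)"
      using closure_of_subset_topspace y by (rule subsetD)
    have "\<exists>t\<in>orbit G (shift G) y. \<forall>x\<in>F. t x = ?\<chi> x"
      if F: "finite F" "F \<subseteq> carrier G" for F
    proof -
      obtain S where S: "finite S" "S \<subseteq> carrier G"
          "\<forall>g\<in>carrier G. \<exists>s\<in>S. s \<otimes> g \<in> return_times G A F"
        by (rule genericE[OF ret[OF F]])
      \<comment> \<open>The element \<open>s\<close> depends on \<open>g\<close>, which is chosen
        only after the window. The window therefore contains the points \<open>x \<otimes> s\<close>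
        for every \<open>s\<close> in \<open>S\<close>; it stays finite because \<open>S\<close> is
        finite.\<close>
      let ?F = "(\<lambda>(x, s). x \<otimes> s) ` (F \<times> S)"
      have "finite ?F \<and> ?F \<subseteq> carrier G"
        using F S(1,2) by auto
      then obtain t where t: "t \<in> orbit G (shift G) ?\<chi>" "\<forall>x\<in>?F. t x = y x"
        using y[unfolded in_closure_of_two_power_iff[OF yt flow.orbit_subset_topspace[OF \<chi>]]]
        by (elim allE[of _ ?F] impE bexE)
      then obtain g where g: "g \<in> carrier G" "t = shift G g ?\<chi>"
        by (auto simp: orbit_def)
      have agree: "shift G g ?\<chi> (x \<otimes> s) = y (x \<otimes> s)" if "x \<in> F" "s \<in> S" for x s
        using t(2) g(2) that by force
      obtain s where s: "s \<in> S" "s \<otimes> g \<in> return_times G A F"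
        using bspec[OF S(3) g(1)] by (rule bexE)
      have sG: "s \<in> carrier G"
        using S(2) s(1) by (rule subsetD)
      have "shift G s y x = ?\<chi> x" if x: "x \<in> F" for x
      proof -
        have xG: "x \<in> carrier G"
          using F(2) x by (rule subsetD)
        have "shift G s y x = y (x \<otimes> s)"
          by (rule shift_apply[OF yt xG])
        also have "\<dots> = shift G g ?\<chi> (x \<otimes> s)"
          by (rule agree[OF x s(1), symmetric])
        also have "\<dots> = shift G s (shift G g ?\<chi>) x"
          using shift_apply[OF flow.element_image[OF g(1) \<chi> refl] xG] by simp
        also have "\<dots> = shift G (s \<otimes> g) ?\<chi> x"
          using shift_mult[OF sG g(1) \<chi>] by simp
        also have "\<dots> = ?\<chi> x"
          using shift_char_fun_agrees_iff[OF F(2), of "s \<otimes> g" A] sG g(1) s(2) x by simp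
        finally show ?thesis .
      qed
      moreover have "shift G s y \<in> orbit G (shift G) y"
        using sG by (auto simp: orbit_def)
      ultimately show ?thesis
        by (intro bexI[of _ "shift G s y"] ballI)
    qed
    then show ?thesis
      unfolding in_closure_of_two_power_iff[OF \<chi> flow.orbit_subset_topspace[OF yt]] by simp
  qed
  then show ?thesis
    unfolding flow.almost_periodic_iff_recurrent[OF \<chi>] by (rule ballI)
qed

end

theorem theorem3p12:
  fixes G :: "('a, 'm) monoid_scheme" and A :: "'a set"
  assumes "group G" and "A \<subseteq> carrier G"
  shows "strongly_generic G A \<longleftrightarrow> almost_periodic G (two_power G) (shift G) (char_fun G A)"
  unfolding group.strongly_generic_iff_return_times[OF assms]
  using group.almost_periodic_imp_generic_return_times[OF assms(1)]
    group.generic_return_times_imp_almost_periodic[OF assms(1)]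
  by (intro iffI allI impI) auto

end
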